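(* In any arithmetic BSM protocol for multiplying $n\times n$ matrices, Carol must use at least $R(n)/2$ multiplication gates.
   Context: Work over the real numbers. Let $X,Y$ be $n\times n$ matrices of indeterminates. An arithmetic BSM protocol for multiplying $n\times n$ matrices consists of a tuple $\mathrm{Alice}(X)$ of polynomials in the entries of $X$, a tuple $\mathrm{Bob}(Y)$ of polynomials in the entries of $Y$, and an arithmetic circuit $\mathrm{Carol}$ (with addition and multiplication gates and real constants) such that $\mathrm{Carol}(\mathrm{Alice}(X),\mathrm{Bob}(Y))$ equals the $n^2$ entries of the product $XY$ as polynomials. The tensor rank $R(n)$ of $n\times n$ matrix multiplication is the smallest number $r$ such that $XY=\sum_{k=1}^{r} \ell_k(X)\,\ell'_k(Y)\,M_k$ for some linear forms $\ell_k$ in the entries of $X$, linear forms $\ell'_k$ in the entries of $Y$, and fixed real $n\times n$ matrices $M_k$. *)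

theory Defs
  imports "Jordan_Normal_Form.Matrix" "HOL-Library.Poly_Mapping"
begin

section \<open>Polynomials in the entries of two matrices of indeterminates\<close>

datatype indet = XVar nat nat | YVar nat nat

text \<open>A monomial is a finitely supported exponent function, a polynomial a finitely supported
  function from monomials to coefficients; addition and multiplication are those of the
  monoid algebra provided by \<^theory>\<open>HOL-Library.Poly_Mapping\<close>.\<close>

type_synonym mpoly = "(indet \<Rightarrow>\<^sub>0 nat) \<Rightarrow>\<^sub>0 real"

definition const_poly :: "real \<Rightarrow> mpoly" where
  "const_poly c = Poly_Mapping.single 0 c"

definition var_poly :: "indet \<Rightarrow> mpoly" where
  "var_poly v = Poly_Mapping.single (Poly_Mapping.single v 1) 1"

definition Xvars :: "nat \<Rightarrow> indet set" where
  "Xvars n = {XVar i j | i j. i < n \<and> j < n}"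

definition Yvars :: "nat \<Rightarrow> indet set" where
  "Yvars n = {YVar i j | i j. i < n \<and> j < n}"

definition X_mat :: "nat \<Rightarrow> mpoly mat" where
  "X_mat n = mat n n (\<lambda>(i, j). var_poly (XVar i j))"

definition Y_mat :: "nat \<Rightarrow> mpoly mat" where
  "Y_mat n = mat n n (\<lambda>(i, j). var_poly (YVar i j))"

definition polys_in :: "indet set \<Rightarrow> mpoly set" where
  "polys_in V = {p. \<forall>m \<in> Poly_Mapping.keys p. Poly_Mapping.keys m \<subseteq> V}"

text \<open>Linear forms are homogeneous of degree one (or zero): there is no constant term.\<close>

definition linear_forms :: "indet set \<Rightarrow> mpoly set" where
  "linear_forms V = {p. \<forall>m \<in> Poly_Mapping.keys p. \<exists>v \<in> V. m = Poly_Mapping.single v 1}"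

section \<open>Tensor rank of matrix multiplication\<close>

definition matmul_decomposition ::
    "nat \<Rightarrow> nat \<Rightarrow> (nat \<Rightarrow> mpoly) \<Rightarrow> (nat \<Rightarrow> mpoly) \<Rightarrow> (nat \<Rightarrow> real mat) \<Rightarrow> bool" where
  "matmul_decomposition n r l l' M \<longleftrightarrow>
     (\<forall>k<r. l k \<in> linear_forms (Xvars n) \<and> l' k \<in> linear_forms (Yvars n)
            \<and> M k \<in> carrier_mat n n) \<and>
     X_mat n * Y_mat n =
       mat n n (\<lambda>(i, j). \<Sum>k<r. l k * l' k * const_poly (M k $$ (i, j)))"

definition matmul_rank :: "nat \<Rightarrow> nat" where
  "matmul_rank n = (LEAST r. \<exists>l l' M. matmul_decomposition n r l l' M)"

text \<open>The standard algorithm shows that the minimum is attained, so \<^const>\<open>matmul_rank\<close> is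
  well defined.\<close>

lemma var_poly_linear_form: "v \<in> V \<Longrightarrow> var_poly v \<in> linear_forms V"
  by (auto simp: var_poly_def linear_forms_def)

lemma matmul_decomposition_exists: "\<exists>r l l' M. matmul_decomposition n r l l' M"
proof -
  define S where "S = {..<n} \<times> {..<n} \<times> {..<n}"
  have "finite S" by (simp add: S_def)
  then obtain h where h: "bij_betw h {0..<card S} S"
    using ex_bij_betw_nat_finite by blast
  define l where "l = (\<lambda>k. case h k of (a, b, c) \<Rightarrow> var_poly (XVar a b))"
  define l' where "l' = (\<lambda>k. case h k of (a, b, c) \<Rightarrow> var_poly (YVar b c))"
  define M where "M = (\<lambda>k. case h k of (a, b, c) \<Rightarrow>
    mat n n (\<lambda>(i, j). if i = a \<and> j = c then 1 else (0::real)))"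
  have hS: "h k \<in> S" if "k < card S" for k
    using bij_betwE[OF h] that by simp
  have forms: "l k \<in> linear_forms (Xvars n) \<and> l' k \<in> linear_forms (Yvars n)
      \<and> M k \<in> carrier_mat n n" if "k < card S" for k
    using hS[OF that]
    by (auto simp: S_def l_def l'_def M_def Xvars_def Yvars_def intro!: var_poly_linear_form)
  have sum: "(\<Sum>k<card S. l k * l' k * const_poly (M k $$ (i, j)))
      = (\<Sum>b<n. var_poly (XVar i b) * var_poly (YVar b j))" if ij: "i < n" "j < n" for i j
  proof -
    define g where "g = (\<lambda>(a, b, c). var_poly (XVar a b) * var_poly (YVar b c) *
      const_poly (if i = a \<and> j = c then 1 else 0))"
    have "(\<Sum>k<card S. l k * l' k * const_poly (M k $$ (i, j))) = (\<Sum>k\<in>{0..<card S}. g (h k))"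
      using ij by (intro sum.cong)
        (auto simp: g_def l_def l'_def M_def lessThan_atLeast0 split: prod.splits)
    also have "\<dots> = sum g S"
      by (rule sum.reindex_bij_betw[OF h])
    also have "\<dots> = sum g ((\<lambda>b. (i, b, j)) ` {..<n})"
      using ij by (intro sum.mono_neutral_right)
        (auto simp: S_def g_def const_poly_def)
    also have "\<dots> = (\<Sum>b<n. g (i, b, j))"
      by (subst sum.reindex) (auto simp: inj_on_def)
    also have "\<dots> = (\<Sum>b<n. var_poly (XVar i b) * var_poly (YVar b j))"
      by (simp add: g_def const_poly_def)
    finally show ?thesis .
  qed
  have "X_mat n * Y_mat n =
      mat n n (\<lambda>(i, j). \<Sum>k<card S. l k * l' k * const_poly (M k $$ (i, j)))"
    by (rule eq_matI)
      (auto simp: X_mat_def Y_mat_def scalar_prod_def sum lessThan_atLeast0[symmetric])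
  with forms show ?thesis
    unfolding matmul_decomposition_def by blast
qed

section \<open>Arithmetic circuits\<close>

text \<open>A circuit is a straight-line program: a list of gates in topological order. An operand
  of an addition or multiplication gate is the position of an earlier gate, whose value may be
  reused any number of times. Inputs and constants are sources, which are only given a
  position in the list.\<close>

datatype gate = Input nat | Const real | Add nat nat | Mult nat nat

record circuit =
  gates :: "gate list"
  outputs :: "nat list"

definition valid_circuit :: "nat \<Rightarrow> circuit \<Rightarrow> bool" where
  "valid_circuit m C \<longleftrightarrow>
     (\<forall>k < length (gates C). case gates C ! k of
         Input i \<Rightarrow> i < m
       | Const c \<Rightarrow> True
       | Add a b \<Rightarrow> a < k \<and> b < k
       | Mult a b \<Rightarrow> a < k \<and> b < k) \<and>
     (\<forall>k \<in> set (outputs C). k < length (gates C))"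

fun gate_value :: "mpoly list \<Rightarrow> mpoly list \<Rightarrow> gate \<Rightarrow> mpoly" where
  "gate_value ins vals (Input i) = ins ! i"
| "gate_value ins vals (Const c) = const_poly c"
| "gate_value ins vals (Add a b) = vals ! a + vals ! b"
| "gate_value ins vals (Mult a b) = vals ! a * vals ! b"

definition gate_values :: "mpoly list \<Rightarrow> gate list \<Rightarrow> mpoly list" where
  "gate_values ins gs = foldl (\<lambda>vals g. vals @ [gate_value ins vals g]) [] gs"

definition circuit_eval :: "circuit \<Rightarrow> mpoly list \<Rightarrow> mpoly list" where
  "circuit_eval C ins = map (\<lambda>k. gate_values ins (gates C) ! k) (outputs C)"

definition num_mult_gates :: "circuit \<Rightarrow> nat" where
  "num_mult_gates C = length (filter (\<lambda>g. \<exists>a b. g = Mult a b) (gates C))"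

section \<open>Arithmetic BSM protocols\<close>

text \<open>Carol outputs the entries of the product in row-major order.\<close>

definition arithmetic_BSM_protocol :: "nat \<Rightarrow> mpoly list \<Rightarrow> mpoly list \<Rightarrow> circuit \<Rightarrow> bool" where
  "arithmetic_BSM_protocol n Alice Bob Carol \<longleftrightarrow>
     set Alice \<subseteq> polys_in (Xvars n) \<and>
     set Bob \<subseteq> polys_in (Yvars n) \<and>
     valid_circuit (length Alice + length Bob) Carol \<and>
     circuit_eval Carol (Alice @ Bob) = concat (mat_to_list (X_mat n * Y_mat n))"

end

theory Submission
  imports Defs
begin

text \<open>
  Write \<open>p\<^sub>m\<close> for the coefficient of a monomial \<open>m\<close> in \<open>p\<close>. For indeterminates \<open>x\<close> of \<open>X\<close> and
  \<open>y\<close> of \<open>Y\<close>, the coefficient of \<open>x y\<close> in a product is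
  \<open>u\<^sub>1 v\<^sub>x\<^sub>y + u\<^sub>x v\<^sub>y + u\<^sub>y v\<^sub>x + u\<^sub>x\<^sub>y v\<^sub>1\<close>. The outer terms are constant multiples of the bilinear
  parts of the factors, and the inner ones are products of linear forms. As Alice's and Bob's
  polynomials have no bilinear part, the bilinear part of each gate lies in the span of the two
  products of linear forms contributed by each multiplication gate.
\<close>

text \<open>Keeps the exponent \<open>1\<close> in \<open>mono1\<close> from being rewritten to
  \<open>Suc 0\<close>, so that facts about \<open>mono1\<close> still match.\<close>

declare One_nat_def [simp del]

section \<open>Coefficients of monomials of degree two\<close>

abbreviation mono1 :: "indet \<Rightarrow> (indet \<Rightarrow>\<^sub>0 nat)" where
  "mono1 v \<equiv> Poly_Mapping.single v 1"

abbreviation bicoeff :: "mpoly \<Rightarrow> indet \<Rightarrow> indet \<Rightarrow> real" where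
  "bicoeff p x y \<equiv> Poly_Mapping.lookup p (mono1 x + mono1 y)"

text \<open>A squarefree monomial of degree two has just four divisors: exponents of a divisor are
  at most 1 at \<open>x\<close> and \<open>y\<close>, and 0 elsewhere.\<close>

lemma add_eq_mono1_add_mono1_cases:
  assumes "x \<noteq> y" and eq: "mono1 x + mono1 y = l + q"
  shows "l \<in> {0, mono1 x, mono1 y, mono1 x + mono1 y}"
proof -
  have lq: "(if v = x then 1 else 0) + (if v = y then 1 else 0)
      = Poly_Mapping.lookup l v + Poly_Mapping.lookup q v" for v
    using arg_cong[OF eq, of "\<lambda>p. Poly_Mapping.lookup p v"]
    by (simp add: lookup_add lookup_single when_def eq_commute)
  have other: "Poly_Mapping.lookup l v = 0" if "v \<noteq> x" "v \<noteq> y" for v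
    using lq[of v] that by simp
  have "Poly_Mapping.lookup l x \<le> 1" "Poly_Mapping.lookup l y \<le> 1"
    using lq[of x] lq[of y] \<open>x \<noteq> y\<close> by auto
  then consider "Poly_Mapping.lookup l x = 0" "Poly_Mapping.lookup l y = 0"
    | "Poly_Mapping.lookup l x = 1" "Poly_Mapping.lookup l y = 0"
    | "Poly_Mapping.lookup l x = 0" "Poly_Mapping.lookup l y = 1"
    | "Poly_Mapping.lookup l x = 1" "Poly_Mapping.lookup l y = 1"
    by linarith
  then have "l = 0 \<or> l = mono1 x \<or> l = mono1 y \<or> l = mono1 x + mono1 y"
  proof cases
    case 1
    then have "l = 0" using other by (intro poly_mapping_eqI) (metis lookup_zero)
    then show ?thesis by simp
  next
    case 2
    then have "l = mono1 x" using other \<open>x \<noteq> y\<close>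
      by (intro poly_mapping_eqI) (metis (full_types) lookup_single_eq lookup_single_not_eq)
    then show ?thesis by simp
  next
    case 3
    then have "l = mono1 y" using other \<open>x \<noteq> y\<close>
      by (intro poly_mapping_eqI) (metis (full_types) lookup_single_eq lookup_single_not_eq)
    then show ?thesis by simp
  next
    case 4
    then have "Poly_Mapping.lookup l v = Poly_Mapping.lookup (mono1 x + mono1 y) v" for v
      using other[of v] \<open>x \<noteq> y\<close> by (auto simp: lookup_add lookup_single when_def)
    then have "l = mono1 x + mono1 y" by (rule poly_mapping_eqI)
    then show ?thesis by simp
  qed
  then show ?thesis by simp
qed

text \<open>Sums of monomials are unordered, so a crossed match \<open>x = y'\<close>,
  \<open>y = x'\<close> has to be excluded; the hypotheses do this.\<close>

lemma mono1_add_mono1_eq_iff: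
  assumes "x \<noteq> y'" "x' \<noteq> y"
  shows "mono1 x + mono1 y = mono1 x' + mono1 y' \<longleftrightarrow> x = x' \<and> y = y'"
proof
  assume eq: "mono1 x + mono1 y = mono1 x' + mono1 y'"
  have "Poly_Mapping.lookup (mono1 x + mono1 y) x = Poly_Mapping.lookup (mono1 x' + mono1 y') x"
    using eq by simp
  then have "x = x'"
    using assms by (auto simp: lookup_add lookup_single when_def split: if_splits)
  moreover from this eq have "mono1 y = mono1 y'" by simp
  then have "y = y'"
    by (metis lookup_single_eq lookup_single_not_eq zero_neq_one)
  ultimately show "x = x' \<and> y = y'" by simp
qed simp

text \<open>The convolution defining the product runs over factorisations of the monomial, and there
  is one for each of its four divisors.\<close>

lemma bicoeff_mult:
  assumes "x \<noteq> y"
  shows "bicoeff (u * v) x y =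
    Poly_Mapping.lookup u 0 * bicoeff v x y
    + Poly_Mapping.lookup u (mono1 x) * Poly_Mapping.lookup v (mono1 y)
    + Poly_Mapping.lookup u (mono1 y) * Poly_Mapping.lookup v (mono1 x)
    + bicoeff u x y * Poly_Mapping.lookup v 0"
proof -
  let ?m = "mono1 x + mono1 y"
  let ?S = "{0, mono1 x, mono1 y, ?m}"
  \<comment> \<open>The inner sum of the convolution: by cancellation it has at most one term, the
    coefficient in \<open>v\<close> of the cofactor of \<open>l\<close>.\<close>
  let ?h = "\<lambda>l. \<Sum>q. Poly_Mapping.lookup v q when ?m = l + q"
  have h: "?h l = Poly_Mapping.lookup v q" if "?m = l + q" for l q
  proof -
    have "?m = l + q' \<longleftrightarrow> q' = q" for q' using that by auto
    then show ?thesis by simp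
  qed
  have zero: "?h l = 0" if "l \<notin> ?S" for l
  proof -
    have "?m \<noteq> l + q" for q
      using add_eq_mono1_add_mono1_cases[OF assms] that by blast
    then show ?thesis by simp
  qed
  \<comment> \<open>The four divisors are distinct, so the sum over \<open>?S\<close> splits into
    four terms.\<close>
  have ne: "mono1 x \<noteq> 0" "mono1 y \<noteq> 0" "mono1 x \<noteq> mono1 y"
    using assms by (metis lookup_single_eq lookup_single_not_eq lookup_zero zero_neq_one)+
  then have ne': "?m \<noteq> 0" "mono1 x \<noteq> ?m" "mono1 y \<noteq> ?m"
    by (auto simp: poly_mapping_eq_iff fun_eq_iff lookup_add)
  have "bicoeff (u * v) x y = (\<Sum>l. Poly_Mapping.lookup u l * ?h l)"
    by (simp add: lookup_mult)
  also have "\<dots> = (\<Sum>l\<in>?S. Poly_Mapping.lookup u l * ?h l)"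
    by (rule Sum_any.expand_superset) (use zero in force)+
  also have "\<dots> = Poly_Mapping.lookup u 0 * ?h 0
      + (Poly_Mapping.lookup u (mono1 x) * ?h (mono1 x)
      + (Poly_Mapping.lookup u (mono1 y) * ?h (mono1 y) + bicoeff u x y * ?h ?m))"
    using ne ne' by simp
  also have "?h 0 = bicoeff v x y" by (rule h) simp
  also have "?h (mono1 x) = Poly_Mapping.lookup v (mono1 y)" by (rule h) simp
  also have "?h (mono1 y) = Poly_Mapping.lookup v (mono1 x)" by (rule h) (simp add: add.commute)
  also have "?h ?m = Poly_Mapping.lookup v 0" by (rule h) simp
  finally show ?thesis by (simp only: add.assoc)
qed

lemma bicoeff_const_poly: "bicoeff (const_poly c) x y = 0"
proof -
  have "mono1 x + mono1 y \<noteq> 0"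
    by (auto simp: poly_mapping_eq_iff fun_eq_iff lookup_add intro!: exI[of _ x])
  then show ?thesis
    by (simp add: const_poly_def lookup_single when_def)
qed

text \<open>Applied to Alice's polynomials through \<open>y\<close> and to Bob's through
  \<open>x\<close>: no input of Carol has a bilinear part.\<close>

lemma bicoeff_polys_in:
  assumes "p \<in> polys_in V" "x \<notin> V \<or> y \<notin> V"
  shows "bicoeff p x y = 0"
proof (rule ccontr)
  assume "bicoeff p x y \<noteq> 0"
  then have "Poly_Mapping.keys (mono1 x + mono1 y) \<subseteq> V"
    using assms(1) by (auto simp: polys_in_def in_keys_iff)
  moreover have "x \<in> Poly_Mapping.keys (mono1 x + mono1 y)"
    "y \<in> Poly_Mapping.keys (mono1 x + mono1 y)"
    by (simp_all add: in_keys_iff lookup_add)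
  ultimately show False using assms(2) by blast
qed

section \<open>Constants, indeterminates and linear forms\<close>

lemma var_poly_mult:
  "var_poly x * var_poly y = Poly_Mapping.single (mono1 x + mono1 y) 1"
  by (simp add: var_poly_def mult_single)

lemma const_poly_add: "const_poly (a + b) = const_poly a + const_poly b"
  by (simp add: const_poly_def single_add)

lemma const_poly_0: "const_poly 0 = 0" and const_poly_1: "const_poly 1 = 1"
  by (simp_all add: const_poly_def)

lemma const_poly_mult: "const_poly (a * b) = const_poly a * const_poly b"
  by (simp add: const_poly_def mult_single)

lemma const_poly_sum: "const_poly (\<Sum>i\<in>I. f i) = (\<Sum>i\<in>I. const_poly (f i))"
  by (induction I rule: infinite_finite_induct) (simp_all add: const_poly_0 const_poly_add)

lemma lookup_const_poly_mult_var_poly: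
  "Poly_Mapping.lookup (const_poly c * var_poly v) m = (c when m = mono1 v)"
  by (auto simp: const_poly_def var_poly_def mult_single lookup_single when_def)

lemma linear_forms_sum:
  "(\<Sum>v\<in>V. const_poly (a v) * var_poly v) \<in> linear_forms V"
  unfolding linear_forms_def mem_Collect_eq
proof
  fix m assume "m \<in> Poly_Mapping.keys (\<Sum>v\<in>V. const_poly (a v) * var_poly v)"
  then have "(\<Sum>v\<in>V. a v when m = mono1 v) \<noteq> 0"
    by (simp add: in_keys_iff lookup_sum lookup_const_poly_mult_var_poly)
  then obtain v where "v \<in> V" "(a v when m = mono1 v) \<noteq> 0"
    by (meson sum.neutral)
  then show "\<exists>v\<in>V. m = mono1 v" by auto
qed

section \<open>Gate values and spans of products of linear forms\<close>

lemma gate_values_snoc: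
  "gate_values ins (gs @ [g]) = gate_values ins gs @ [gate_value ins (gate_values ins gs) g]"
  by (simp add: gate_values_def)

lemma length_gate_values: "length (gate_values ins gs) = length gs"
  by (induction gs rule: rev_induct) (simp_all add: gate_values_snoc, simp add: gate_values_def)

text \<open>\<open>A t\<close> and \<open>B t\<close> are coefficient vectors of linear forms in
  \<open>V\<close> and \<open>W\<close>. They are parameters, while \<open>c\<close> is quantified,
  so that many polynomials can share the same \<open>r\<close> products. Coefficients of other
  monomials of \<open>p\<close> are unconstrained.\<close>

definition in_bilinear_span ::
    "indet set \<Rightarrow> indet set \<Rightarrow> nat \<Rightarrow> (nat \<Rightarrow> indet \<Rightarrow> real) \<Rightarrow> (nat \<Rightarrow> indet \<Rightarrow> real) \<Rightarrow> mpoly \<Rightarrow> bool"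
  where "in_bilinear_span V W r A B p \<longleftrightarrow>
    (\<exists>c. \<forall>x\<in>V. \<forall>y\<in>W. bicoeff p x y = (\<Sum>t<r. A t x * B t y * c t))"

lemma in_bilinear_span_zero:
  assumes "\<And>x y. x \<in> V \<Longrightarrow> y \<in> W \<Longrightarrow> bicoeff p x y = 0"
  shows "in_bilinear_span V W r A B p"
  unfolding in_bilinear_span_def using assms by (intro exI[of _ "\<lambda>_. 0"]) simp

lemma in_bilinear_span_add:
  assumes "in_bilinear_span V W r A B p" "in_bilinear_span V W r A B q"
  shows "in_bilinear_span V W r A B (p + q)"
proof -
  from assms obtain c d where
    "\<forall>x\<in>V. \<forall>y\<in>W. bicoeff p x y = (\<Sum>t<r. A t x * B t y * c t)"
    "\<forall>x\<in>V. \<forall>y\<in>W. bicoeff q x y = (\<Sum>t<r. A t x * B t y * d t)"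
    unfolding in_bilinear_span_def by blast
  then show ?thesis
    unfolding in_bilinear_span_def
    by (intro exI[of _ "\<lambda>t. c t + d t"]) (simp add: lookup_add distrib_left sum.distrib)
qed

text \<open>Giving coefficient 0 to the added products preserves what is known of earlier gates when
  a later gate enlarges the family.\<close>

lemma in_bilinear_span_extend:
  assumes "in_bilinear_span V W r A B p" "r \<le> r'"
    and "\<And>t. t < r \<Longrightarrow> A' t = A t" "\<And>t. t < r \<Longrightarrow> B' t = B t"
  shows "in_bilinear_span V W r' A' B' p"
proof -
  from assms(1) obtain c where
    c: "\<forall>x\<in>V. \<forall>y\<in>W. bicoeff p x y = (\<Sum>t<r. A t x * B t y * c t)"
    unfolding in_bilinear_span_def by blast
  have "(\<Sum>t<r'. A' t x * B' t y * (if t < r then c t else 0)) = (\<Sum>t<r. A t x * B t y * c t)" for x y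
    using assms(2-4) by (intro sum.mono_neutral_cong_right) auto
  with c show ?thesis
    unfolding in_bilinear_span_def by (intro exI[of _ "\<lambda>t. if t < r then c t else 0"]) simp
qed

text \<open>In \<open>bicoeff_mult\<close> the outer terms stay in the old span and the inner two
  are the new products. These two products per multiplication are the source of the factor 2 in the
  bound.\<close>

lemma in_bilinear_span_mult:
  assumes "V \<inter> W = {}"
    and "in_bilinear_span V W r A B u" "in_bilinear_span V W r A B v"
  shows "in_bilinear_span V W (Suc (Suc r))
    (A(r := \<lambda>x. Poly_Mapping.lookup u (mono1 x), Suc r := \<lambda>x. Poly_Mapping.lookup v (mono1 x)))
    (B(r := \<lambda>y. Poly_Mapping.lookup v (mono1 y), Suc r := \<lambda>y. Poly_Mapping.lookup u (mono1 y)))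
    (u * v)"
    (is "in_bilinear_span V W _ ?A ?B _")
proof -
  from assms(2,3) obtain c d where
    c: "\<forall>x\<in>V. \<forall>y\<in>W. bicoeff u x y = (\<Sum>t<r. A t x * B t y * c t)" and
    d: "\<forall>x\<in>V. \<forall>y\<in>W. bicoeff v x y = (\<Sum>t<r. A t x * B t y * d t)"
    unfolding in_bilinear_span_def by blast
  \<comment> \<open>The value 1 is taken at the indices \<open>r\<close> and \<open>Suc r\<close>,
    where each new product enters once.\<close>
  define e where "e t = (if t < r
    then Poly_Mapping.lookup u 0 * d t + c t * Poly_Mapping.lookup v 0 else 1)" for t
  have "bicoeff (u * v) x y = (\<Sum>t<Suc (Suc r). ?A t x * ?B t y * e t)"
    if xy: "x \<in> V" "y \<in> W" for x y
  proof -
    have "x \<noteq> y" using xy assms(1) by blast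
    have "(\<Sum>t<r. ?A t x * ?B t y * e t) = (\<Sum>t<r. A t x * B t y *
        (Poly_Mapping.lookup u 0 * d t + c t * Poly_Mapping.lookup v 0))"
      by (intro sum.cong) (simp_all add: e_def)
    also have "\<dots> = Poly_Mapping.lookup u 0 * bicoeff v x y
        + bicoeff u x y * Poly_Mapping.lookup v 0"
      using c d xy
      by (simp add: sum_distrib_left sum_distrib_right sum.distrib algebra_simps)
    finally show ?thesis
      using bicoeff_mult[OF \<open>x \<noteq> y\<close>, of u v] by (simp add: e_def)
  qed
  then show ?thesis unfolding in_bilinear_span_def by blast
qed

section \<open>Propagation through the circuit\<close>

text \<open>The condition of \<open>valid_circuit\<close> on a single gate, isolated so that an
  induction can run over prefixes of the gate list.\<close>

definition valid_gate :: "nat \<Rightarrow> nat \<Rightarrow> gate \<Rightarrow> bool" where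
  "valid_gate m k g = (case g of
         Input i \<Rightarrow> i < m
       | Const c \<Rightarrow> True
       | Add a b \<Rightarrow> a < k \<and> b < k
       | Mult a b \<Rightarrow> a < k \<and> b < k)"

text \<open>Induction by appending a gate, whose operands are earlier values. Only a multiplication
  gate changes the family of products.\<close>

lemma gate_values_in_bilinear_span:
  assumes "V \<inter> W = {}"
    and ins: "\<And>p x y. p \<in> set ins \<Longrightarrow> x \<in> V \<Longrightarrow> y \<in> W \<Longrightarrow> bicoeff p x y = 0"
    and "\<And>k. k < length gs \<Longrightarrow> valid_gate (length ins) k (gs ! k)"
  shows "\<exists>A B. \<forall>p \<in> set (gate_values ins gs).
    in_bilinear_span V W (2 * length (filter (\<lambda>g. \<exists>a b. g = Mult a b) gs)) A B p"
  using assms(3)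
proof (induction gs rule: rev_induct)
  case Nil
  show ?case by (simp add: gate_values_def)
next
  case (snoc g gs)
  let ?r = "2 * length (filter (\<lambda>g. \<exists>a b. g = Mult a b) gs)"
  let ?vals = "gate_values ins gs"
  have "valid_gate (length ins) k (gs ! k)" if "k < length gs" for k
    using snoc.prems[of k] that by (simp add: nth_append)
  from snoc.IH[OF this] obtain A B where
    AB: "\<And>p. p \<in> set ?vals \<Longrightarrow> in_bilinear_span V W ?r A B p"
    by blast
  have nth: "in_bilinear_span V W ?r A B (?vals ! a)" if "a < length gs" for a
    using AB that by (simp add: length_gate_values)
  have g: "valid_gate (length ins) (length gs) g"
    using snoc.prems[of "length gs"] by simp
  show ?case
  proof (cases g)
    case (Input i)
    with g have "ins ! i \<in> set ins" by (simp add: valid_gate_def)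
    with Input have "in_bilinear_span V W ?r A B (gate_value ins ?vals g)"
      using ins by (auto intro!: in_bilinear_span_zero)
    with AB Input show ?thesis
      by (intro exI[of _ A] exI[of _ B]) (auto simp: gate_values_snoc)
  next
    case (Const c)
    then have "in_bilinear_span V W ?r A B (gate_value ins ?vals g)"
      using bicoeff_const_poly by (auto intro!: in_bilinear_span_zero)
    with AB Const show ?thesis
      by (intro exI[of _ A] exI[of _ B]) (auto simp: gate_values_snoc)
  next
    case (Add a b)
    then have "in_bilinear_span V W ?r A B (gate_value ins ?vals g)"
      using g nth by (auto simp: valid_gate_def intro!: in_bilinear_span_add)
    with AB Add show ?thesis
      by (intro exI[of _ A] exI[of _ B]) (auto simp: gate_values_snoc)
  next
    case (Mult a b)
    \<comment> \<open>The count \<open>?r\<close> grows by two here, which makes room for the new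
      products at \<open>?r\<close> and \<open>Suc ?r\<close>.\<close>
    define A' where "A' = A(?r := \<lambda>x. Poly_Mapping.lookup (?vals ! a) (mono1 x),
      Suc ?r := \<lambda>x. Poly_Mapping.lookup (?vals ! b) (mono1 x))"
    define B' where "B' = B(?r := \<lambda>y. Poly_Mapping.lookup (?vals ! b) (mono1 y),
      Suc ?r := \<lambda>y. Poly_Mapping.lookup (?vals ! a) (mono1 y))"
    have "in_bilinear_span V W (Suc (Suc ?r)) A' B' (?vals ! a * ?vals ! b)"
      unfolding A'_def B'_def
      using g Mult by (intro in_bilinear_span_mult assms(1) nth) (simp_all add: valid_gate_def)
    moreover have "in_bilinear_span V W (Suc (Suc ?r)) A' B' p" if "p \<in> set ?vals" for p
      using AB[OF that] by (rule in_bilinear_span_extend) (simp_all add: A'_def B'_def)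
    ultimately show ?thesis
      using Mult by (intro exI[of _ A'] exI[of _ B']) (auto simp: gate_values_snoc)
  qed
qed

section \<open>From bilinear coefficients to tensor rank\<close>

lemma finite_Xvars: "finite (Xvars n)" and finite_Yvars: "finite (Yvars n)"
proof -
  have "Xvars n = (\<lambda>(i, j). XVar i j) ` ({..<n} \<times> {..<n})"
    "Yvars n = (\<lambda>(i, j). YVar i j) ` ({..<n} \<times> {..<n})"
    by (auto simp: Xvars_def Yvars_def)
  then show "finite (Xvars n)" "finite (Yvars n)" by simp_all
qed

lemma Xvars_Yvars_disjoint: "Xvars n \<inter> Yvars n = {}"
  by (auto simp: Xvars_def Yvars_def)

lemma matmul_entry:
  assumes "i < n" "j < n"
  shows "(X_mat n * Y_mat n) $$ (i, j) = (\<Sum>b<n. var_poly (XVar i b) * var_poly (YVar b j))"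
  using assms by (simp add: X_mat_def Y_mat_def scalar_prod_def lessThan_atLeast0)

lemma bilinear_expansion_var_poly_mult:
  assumes "finite V" "finite W" "V \<inter> W = {}" "x' \<in> V" "y' \<in> W"
  shows "(\<Sum>x\<in>V. \<Sum>y\<in>W. const_poly (bicoeff (var_poly x' * var_poly y') x y)
    * (var_poly x * var_poly y)) = var_poly x' * var_poly y'"
proof -
  have "(\<Sum>x\<in>V. \<Sum>y\<in>W. const_poly (bicoeff (var_poly x' * var_poly y') x y)
      * (var_poly x * var_poly y))
    = (\<Sum>x\<in>V. \<Sum>y\<in>W. if y = y' then (if x = x' then var_poly x * var_poly y else 0) else 0)"
  proof (intro sum.cong refl)
    fix x y assume "x \<in> V" "y \<in> W"
    then have "x' \<noteq> y" "x \<noteq> y'" using assms by blast+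
    then have "mono1 x' + mono1 y' = mono1 x + mono1 y \<longleftrightarrow> x' = x \<and> y' = y"
      by (intro mono1_add_mono1_eq_iff) simp_all
    then have "bicoeff (var_poly x' * var_poly y') x y = (if x = x' \<and> y = y' then 1 else 0)"
      by (auto simp: var_poly_mult lookup_single when_def)
    then show "const_poly (bicoeff (var_poly x' * var_poly y') x y) * (var_poly x * var_poly y)
        = (if y = y' then (if x = x' then var_poly x * var_poly y else 0) else 0)"
      by (simp add: const_poly_0 const_poly_1)
  qed
  also have "\<dots> = var_poly x' * var_poly y'"
    using assms by simp
  finally show ?thesis .
qed

text \<open>Coefficient extraction is linear, so the expansion of a single product carries over to
  the sum. This turns statements about coefficients back into a polynomial identity.\<close>

lemma bilinear_expansion_matmul_entry:
  assumes "i < n" "j < n"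
  shows "(X_mat n * Y_mat n) $$ (i, j) = (\<Sum>x\<in>Xvars n. \<Sum>y\<in>Yvars n.
    const_poly (bicoeff ((X_mat n * Y_mat n) $$ (i, j)) x y) * (var_poly x * var_poly y))"
proof -
  let ?p = "\<lambda>b. var_poly (XVar i b) * var_poly (YVar b j)"
  have "(\<Sum>x\<in>Xvars n. \<Sum>y\<in>Yvars n. const_poly (bicoeff (\<Sum>b<n. ?p b) x y) * (var_poly x * var_poly y))
      = (\<Sum>x\<in>Xvars n. \<Sum>b<n. \<Sum>y\<in>Yvars n. const_poly (bicoeff (?p b) x y) * (var_poly x * var_poly y))"
    unfolding lookup_sum const_poly_sum sum_distrib_right
    by (intro sum.cong refl sum.swap)
  also have "\<dots> = (\<Sum>b<n. \<Sum>x\<in>Xvars n. \<Sum>y\<in>Yvars n. const_poly (bicoeff (?p b) x y) * (var_poly x * var_poly y))"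
    by (rule sum.swap)
  also have "\<dots> = (\<Sum>b<n. ?p b)"
    using assms
    by (intro sum.cong refl bilinear_expansion_var_poly_mult finite_Xvars finite_Yvars
        Xvars_Yvars_disjoint) (auto simp: Xvars_def Yvars_def)
  finally show ?thesis
    unfolding matmul_entry[OF assms] by simp
qed

text \<open>The shared families \<open>A\<close> and \<open>B\<close> supply the linear forms of a
  decomposition of length \<open>r\<close>, and the span coefficients of entry \<open>(i, j)\<close>
  supply the \<open>(i, j)\<close> entries of the matrices.\<close>

lemma matmul_rank_le:
  assumes "\<And>i j. i < n \<Longrightarrow> j < n \<Longrightarrow>
    in_bilinear_span (Xvars n) (Yvars n) r A B ((X_mat n * Y_mat n) $$ (i, j))"
  shows "matmul_rank n \<le> r"
proof -
  let ?P = "X_mat n * Y_mat n"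
  \<comment> \<open>The span hypothesis yields coefficients for each entry separately; choice
    collects them into one function.\<close>
  define c where "c i j = (SOME c. \<forall>x\<in>Xvars n. \<forall>y\<in>Yvars n.
    bicoeff (?P $$ (i, j)) x y = (\<Sum>t<r. A t x * B t y * c t))" for i j
  have c: "bicoeff (?P $$ (i, j)) x y = (\<Sum>t<r. A t x * B t y * c i j t)"
    if "i < n" "j < n" "x \<in> Xvars n" "y \<in> Yvars n" for i j x y
    using someI_ex[OF assms[OF that(1,2), unfolded in_bilinear_span_def]] that(3,4)
    unfolding c_def by blast
  define l where "l t = (\<Sum>x\<in>Xvars n. const_poly (A t x) * var_poly x)" for t
  define l' where "l' t = (\<Sum>y\<in>Yvars n. const_poly (B t y) * var_poly y)" for t
  define M where "M t = mat n n (\<lambda>(i, j). c i j t)" for t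
  have entry: "?P $$ (i, j) = (\<Sum>t<r. l t * l' t * const_poly (M t $$ (i, j)))"
    if ij: "i < n" "j < n" for i j
  proof -
    have "?P $$ (i, j) = (\<Sum>x\<in>Xvars n. \<Sum>y\<in>Yvars n.
        const_poly (\<Sum>t<r. A t x * B t y * c i j t) * (var_poly x * var_poly y))"
      \<comment> \<open>The entry occurs on both sides of its expansion, so the expansion is applied
        once by transitivity instead of as a rewrite rule.\<close>
      by (rule bilinear_expansion_matmul_entry[OF ij, THEN trans])
        (intro sum.cong refl, simp only: c[OF ij])
    also have "\<dots> = (\<Sum>x\<in>Xvars n. \<Sum>y\<in>Yvars n. \<Sum>t<r.
        const_poly (A t x) * var_poly x * (const_poly (B t y) * var_poly y) * const_poly (c i j t))"
      unfolding const_poly_sum const_poly_mult sum_distrib_right by (simp only: mult_ac)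
    also have "\<dots> = (\<Sum>x\<in>Xvars n. \<Sum>t<r. \<Sum>y\<in>Yvars n.
        const_poly (A t x) * var_poly x * (const_poly (B t y) * var_poly y) * const_poly (c i j t))"
      by (intro sum.cong refl sum.swap)
    also have "\<dots> = (\<Sum>t<r. \<Sum>x\<in>Xvars n. \<Sum>y\<in>Yvars n.
        const_poly (A t x) * var_poly x * (const_poly (B t y) * var_poly y) * const_poly (c i j t))"
      by (rule sum.swap)
    also have "\<dots> = (\<Sum>t<r. l t * l' t * const_poly (M t $$ (i, j)))"
      unfolding l_def l'_def sum_product unfolding sum_distrib_right using ij by (simp add: M_def)
    finally show ?thesis .
  qed
  have "?P = mat n n (\<lambda>(i, j). \<Sum>t<r. l t * l' t * const_poly (M t $$ (i, j)))"
    \<comment> \<open>Without the deletion, the entry of the product would unfold to a scalar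
      product and \<open>entry\<close> would not match.\<close>
    by (rule eq_matI) (simp_all add: entry del: index_mult_mat(1), simp_all add: X_mat_def Y_mat_def)
  then have "matmul_decomposition n r l l' M"
    unfolding matmul_decomposition_def
    by (simp add: l_def l'_def M_def linear_forms_sum)
  then show ?thesis
    unfolding matmul_rank_def by (intro Least_le) blast
qed

theorem theorem3p1:
  fixes n :: nat and Alice Bob :: "mpoly list" and Carol :: circuit
  assumes "arithmetic_BSM_protocol n Alice Bob Carol"
  shows "real (num_mult_gates Carol) \<ge> real (matmul_rank n) / 2"
proof -
  let ?ins = "Alice @ Bob"
  let ?P = "X_mat n * Y_mat n"
  from assms have A: "set Alice \<subseteq> polys_in (Xvars n)" and B: "set Bob \<subseteq> polys_in (Yvars n)"
    and valid: "valid_circuit (length Alice + length Bob) Carol"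
    and eval: "circuit_eval Carol ?ins = concat (mat_to_list ?P)"
    by (simp_all add: arithmetic_BSM_protocol_def)
  have "bicoeff p x y = 0" if "p \<in> set ?ins" "x \<in> Xvars n" "y \<in> Yvars n" for p x y
    using that A B Xvars_Yvars_disjoint[of n] by (auto intro: bicoeff_polys_in)
  moreover have "valid_gate (length ?ins) k (gates Carol ! k)" if "k < length (gates Carol)" for k
    using valid that by (simp add: valid_circuit_def valid_gate_def)
  ultimately obtain A B where AB: "\<And>p. p \<in> set (gate_values ?ins (gates Carol)) \<Longrightarrow>
      in_bilinear_span (Xvars n) (Yvars n) (2 * num_mult_gates Carol) A B p"
    using gate_values_in_bilinear_span[OF Xvars_Yvars_disjoint, of ?ins]
    unfolding num_mult_gates_def by meson
  have "?P $$ (i, j) \<in> set (gate_values ?ins (gates Carol))" if "i < n" "j < n" for i j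
  proof -
    \<comment> \<open>Only membership among the outputs matters, not their row-major order: one
      family of products serves all gates.\<close>
    have "?P $$ (i, j) \<in> set (concat (mat_to_list ?P))"
      using that by (force simp: mat_to_list_def X_mat_def Y_mat_def simp del: index_mult_mat(1))
    then have "?P $$ (i, j) \<in> set (circuit_eval Carol ?ins)"
      by (simp only: eval)
    then show ?thesis
      using valid by (auto simp: circuit_eval_def valid_circuit_def length_gate_values)
  qed
  then have "matmul_rank n \<le> 2 * num_mult_gates Carol"
    using AB by (intro matmul_rank_le) blast
  then show ?thesis by linarith
qed

end
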